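(* For every constant $C>0$ there is a constant $C'>0$, depending only on $C$, such that the following holds for every integer $N\ge 2$. Let $S\subset\mathbb{R}^2$ be a set of $N$ points such that every straight line in $\mathbb{R}^2$ contains at most $C\sqrt{N}$ points of $S$. Then, for any real $\lambda\neq 0$, the number of quadruples $(p,p',q,q')\in S\times S\times S\times S$ with $p_1\neq p_1'$, $q_1\neq q_1'$ and $$\lambda\,\frac{p_2-p_2'}{p_1-p_1'}=\frac{q_2-q_2'}{q_1-q_1'}$$ is at most $C'\,N^3\log N$.
   Context: Coordinates are written $p=(p_1,p_2)$, $p'=(p_1',p_2')$, $q=(q_1,q_2)$, $q'=(q_1',q_2')$. *)

theory Defs
  imports "HOL-Analysis.Analysis"
begin

definition straight_line :: "(real ^ 2) set \<Rightarrow> bool" where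
  "straight_line L \<longleftrightarrow> affine L \<and> aff_dim L = 1"

definition slope :: "real ^ 2 \<Rightarrow> real ^ 2 \<Rightarrow> real" where
  "slope p p' = (p $ 2 - p' $ 2) / (p $ 1 - p' $ 1)"

definition slope_quadruples ::
    "real \<Rightarrow> (real ^ 2) set \<Rightarrow> ((real ^ 2) \<times> (real ^ 2) \<times> (real ^ 2) \<times> (real ^ 2)) set" where
  "slope_quadruples l S =
     {(p, p', q, q'). p \<in> S \<and> p' \<in> S \<and> q \<in> S \<and> q' \<in> S \<and>
        p $ 1 \<noteq> p' $ 1 \<and> q $ 1 \<noteq> q' $ 1 \<and> l * slope p p' = slope q q'}"

end

theory Submission
  imports Defs
begin

text \<open>
  For a line \<open>g\<close> let \<open>n g\<close> be the number of points of \<open>S\<close> on it.  A quadruple consists of two pairs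
  whose slopes determine each other, because \<open>\<lambda> \<noteq> 0\<close>.  Consider the quadruples in which the line
  through the first pair carries at least as many points as the line through the second.  If the
  first pair is fixed, there are \<open>N\<close> choices for one point of the second pair, and then the other
  point lies on a line of prescribed slope with at most as many points as the line of the first pair.
  Hence the number of quadruples is at most \<open>2 * N * T\<close>, where \<open>T\<close> is the sum of \<open>n g\<close> over all
  pairs of points with distinct first coordinates, \<open>g\<close> being the line through the pair; so \<open>T\<close> is
  at most the sum of \<open>n g ^ 3\<close> over all lines \<open>g\<close> spanned by \<open>S\<close>
  (\<open>slope_quadruples_le_collinear_triples\<close>).

  The Szemeredi-Trotter bound says that the number of lines with at least \<open>k\<close> points is at most a
  constant times \<open>N ^ 2 / k ^ 3 + N / k\<close>.  No line has more than \<open>C * sqrt N\<close> points, so the first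
  term dominates, and summing \<open>k ^ 2 * (N ^ 2 / k ^ 3)\<close> over \<open>k\<close> shows that \<open>T\<close> is at most a constant
  times \<open>N ^ 2 * ln N\<close> (\<open>collinear_triples_bound\<close>).

  The Szemeredi-Trotter bound follows from the crossing lemma applied to the graph whose edges
  join consecutive points on the rich lines (\<open>szemeredi_trotter_rich_lines\<close>).  The crossing lemma in
  turn follows, by averaging over random induced subgraphs, from the fact that a crossing-free graph
  with straight edges has at most linearly many edges.  For this fact Euler's formula is replaced by
  a charging argument: every edge is charged to one of its ends or to a vertex that sees it straight
  below, and each vertex receives at most three charges (\<open>edge_charged\<close>, \<open>card_edges_le\<close>).
\<close>

section \<open>Straight segments over the first coordinate\<close>

lemma vec2_eqI: "p = q" if "p $ 1 = q $ 1" "p $ 2 = q $ 2" for p q :: "real ^ 2"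
  using that by (simp add: vec_eq_iff forall_2)

text \<open>
  A segment is stored as the pair of its left and its right end, so that the segment is the graph
  of an affine function over the open interval of first coordinates between the ends.  The height
  extends this function to the whole line, which lets heights be compared at the ends as well.
\<close>
definition height :: "(real ^ 2) \<times> (real ^ 2) \<Rightarrow> real \<Rightarrow> real" where
  "height e x = fst e $ 2 + slope (fst e) (snd e) * (x - fst e $ 1)"

definition shadow :: "(real ^ 2) \<times> (real ^ 2) \<Rightarrow> real set" where
  "shadow e = {fst e $ 1 <..< snd e $ 1}"

definition crosses :: "(real ^ 2) \<times> (real ^ 2) \<Rightarrow> (real ^ 2) \<times> (real ^ 2) \<Rightarrow> bool" where
  "crosses e f \<longleftrightarrow> e \<noteq> f \<and> (\<exists>x\<in>shadow e \<inter> shadow f. height e x = height f x)"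

lemma height_fst [simp]: "height e (fst e $ 1) = fst e $ 2"
  by (simp add: height_def)

lemma height_snd: "height e (snd e $ 1) = snd e $ 2" if "fst e $ 1 < snd e $ 1"
  using that by (simp add: height_def slope_def field_simps)

lemma continuous_height: "continuous_on A (height e)"
  unfolding height_def by (intro continuous_intros)

text \<open>
  The intermediate value theorem.  The points \<open>a\<close> and \<open>b\<close> come in either order because the
  lemma is applied to segments that are above another one on either side.
\<close>
lemma heights_meet:
  assumes "height f a < height e a" "height e b < height f b" "a \<noteq> b"
  shows "\<exists>x. min a b < x \<and> x < max a b \<and> height e x = height f x"
proof -
  let ?d = "\<lambda>x. height f x - height e x"
  have ivt: "\<exists>x. s < x \<and> x < t \<and> ?d x = 0" if "s < t" "?d s * ?d t < 0" for s t
  proof -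
    have cont: "continuous_on {s..t} ?d" "continuous_on {s..t} (\<lambda>x. - ?d x)"
      by (intro continuous_intros continuous_height)+
    have "\<exists>x\<ge>s. x \<le> t \<and> ?d x = 0"
      using IVT'[OF _ _ _ cont(1), of 0] IVT'[OF _ _ _ cont(2), of 0] that
      by (smt (verit) mult_nonneg_nonneg mult_nonpos_nonpos)
    then show ?thesis using that by (metis less_eq_real_def mult_eq_0_iff less_irrefl)
  qed
  have "?d a * ?d b < 0" "?d b * ?d a < 0"
    using assms by (simp_all add: mult_less_0_iff)
  then show ?thesis
    using ivt[of a b] ivt[of b a] \<open>a \<noteq> b\<close> by (cases "a < b") (auto simp: min_def max_def)
qed

lemma heights_coincide:
  assumes "height e a = height f a" "height e b = height f b" "a \<noteq> b"
  shows "height e = height f"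
proof
  fix x
  let ?s = "slope (fst e) (snd e)" and ?t = "slope (fst f) (snd f)"
  have "(?s - ?t) * (a - b) = 0"
    using assms(1,2) by (simp add: height_def algebra_simps)
  then have "?s = ?t" using assms(3) by simp
  then show "height e x = height f x"
    using assms(1) by (simp add: height_def algebra_simps)
qed

text \<open>
  Since an edge contains no further vertex, two edges that share more than one point are equal:
  an overlap would begin or end at a vertex inside one of them.  Vertices may lie on a common
  vertical line, and crossings are still allowed.
\<close>
locale segment_graph =
  fixes V :: "(real ^ 2) set" and E :: "((real ^ 2) \<times> (real ^ 2)) set"
  assumes finite_V: "finite V"
    and E_sub: "E \<subseteq> V \<times> V"
    and left_right: "e \<in> E \<Longrightarrow> fst e $ 1 < snd e $ 1"
    and no_inner_vertex: "\<lbrakk>e \<in> E; w \<in> V; w $ 1 \<in> shadow e\<rbrakk> \<Longrightarrow> height e (w $ 1) \<noteq> w $ 2"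
begin

lemma finite_E: "finite E"
  using finite_V E_sub finite_subset by blast

lemma ends_in_V: "fst e \<in> V" "snd e \<in> V" if "e \<in> E"
  using that E_sub by auto

lemma edge_eqI:
  assumes "e \<in> E" "f \<in> E" "height e = height f" "x \<in> shadow e" "x \<in> shadow f"
  shows "e = f"
proof -
  have h: "height f (fst e $ 1) = fst e $ 2" "height f (snd e $ 1) = snd e $ 2"
    "height e (fst f $ 1) = fst f $ 2" "height e (snd f $ 1) = snd f $ 2"
    using assms(3) height_fst height_snd left_right assms(1,2) by metis+
  have "fst e $ 1 \<notin> shadow f" "snd e $ 1 \<notin> shadow f" "fst f $ 1 \<notin> shadow e" "snd f $ 1 \<notin> shadow e"
    using no_inner_vertex ends_in_V assms(1,2) h by blast+
  then have "fst e $ 1 = fst f $ 1" "snd e $ 1 = snd f $ 1"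
    using assms(4,5) by (auto simp: shadow_def)
  moreover have "height f (snd f $ 1) = snd f $ 2"
    using height_snd left_right assms(2) by blast
  ultimately have "fst e = fst f" "snd e = snd f"
    using h height_fst[of f] by (auto intro!: vec2_eqI)
  then show ?thesis by (simp add: prod_eq_iff)
qed

text \<open>
  A crossing and a common end would be two common points of the edges.  Four distinct ends are what
  makes the exponent of \<open>m\<close> for a crossing exceed the one for an edge by two when vertices are
  sampled.
\<close>
lemma crossing_ends_distinct:
  assumes "e \<in> E" "f \<in> E" "crosses e f"
  shows "card {fst e, snd e, fst f, snd f} = 4"
proof -
  obtain x where x: "x \<in> shadow e" "x \<in> shadow f" "height e x = height f x" and "e \<noteq> f"
    using assms(3) by (auto simp: crosses_def)
  have ne: "height e y \<noteq> height f y" if "y \<noteq> x" for y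
    using heights_coincide[OF _ x(3) that] edge_eqI[OF assms(1,2) _ x(1,2)] \<open>e \<noteq> f\<close> by blast
  have lr: "fst e $ 1 < x" "x < snd e $ 1" "fst f $ 1 < x" "x < snd f $ 1"
    using x by (auto simp: shadow_def)
  have "fst e \<noteq> fst f"
    using ne[of "fst e $ 1"] lr height_fst by (metis less_irrefl)
  moreover have "snd e \<noteq> snd f"
    using ne[of "snd e $ 1"] lr height_snd left_right assms by (metis less_irrefl)
  moreover have "fst e \<noteq> snd e" "fst e \<noteq> snd f" "snd e \<noteq> fst f" "fst f \<noteq> snd f"
    using lr by auto
  ultimately show ?thesis by simp
qed

end

section \<open>Crossing-free straight-line graphs have linearly many edges\<close>

lemma card_related_le:
  assumes "finite A" "\<And>a x y. R a x \<Longrightarrow> R a y \<Longrightarrow> x = y"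
  shows "card {x. \<exists>a\<in>A. R a x} \<le> card A" "finite {x. \<exists>a\<in>A. R a x}"
proof -
  have "{x. \<exists>a\<in>A. R a x} \<subseteq> (\<lambda>a. THE x. R a x) ` A"
    using assms(2) by (auto simp: image_iff intro!: bexI the_equality[symmetric])
  then show "card {x. \<exists>a\<in>A. R a x} \<le> card A" "finite {x. \<exists>a\<in>A. R a x}"
    using surj_card_le[OF assms(1)] finite_subset finite_imageI[OF assms(1)] by blast+
qed

locale plane_segment_graph = segment_graph +
  assumes no_crossing: "\<lbrakk>e \<in> E; f \<in> E; x \<in> shadow e; x \<in> shadow f; height e x = height f x\<rbrakk> \<Longrightarrow> e = f"
begin

lemma edge_eq_fst:
  assumes "e \<in> E" "f \<in> E" "fst e = fst f" "slope (fst e) (snd e) = slope (fst f) (snd f)"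
  shows "e = f"
proof -
  obtain x where "fst e $ 1 < x" "x < min (snd e $ 1) (snd f $ 1)"
    using dense[of "fst e $ 1" "min (snd e $ 1) (snd f $ 1)"] left_right[of e] left_right[of f] assms
    by auto
  then show ?thesis
    using no_crossing[of e f x] assms by (simp add: shadow_def height_def)
qed

lemma height_from_snd:
  "height e x = snd e $ 2 - slope (fst e) (snd e) * (snd e $ 1 - x)" if "e \<in> E"
  using height_snd[of e] left_right[OF that] by (simp add: height_def algebra_simps)

lemma edge_eq_snd:
  assumes "e \<in> E" "f \<in> E" "snd e = snd f" "slope (fst e) (snd e) = slope (fst f) (snd f)"
  shows "e = f"
proof -
  obtain x where "max (fst e $ 1) (fst f $ 1) < x" "x < snd e $ 1"
    using dense[of "max (fst e $ 1) (fst f $ 1)" "snd e $ 1"] left_right[of e] left_right[of f] assms by auto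
  then show ?thesis
    using no_crossing[of e f x] assms by (simp add: shadow_def height_from_snd)
qed

text \<open>
  Each edge is charged to a vertex in one of three ways: to its left end, if no other edge leaves
  this vertex above it; to its right end, if no other edge arrives there above it (arriving above
  means having the smaller slope); or to a vertex above it from which, looking straight down, it
  is the first edge met at an inner point.  A vertex is charged at most once in each way.
\<close>
definition highest_from :: "real ^ 2 \<Rightarrow> (real ^ 2) \<times> (real ^ 2) \<Rightarrow> bool" where
  "highest_from u e \<longleftrightarrow> e \<in> E \<and> fst e = u \<and>
     (\<forall>f\<in>E. fst f = u \<longrightarrow> slope (fst f) (snd f) \<le> slope (fst e) (snd e))"

definition highest_into :: "real ^ 2 \<Rightarrow> (real ^ 2) \<times> (real ^ 2) \<Rightarrow> bool" where
  "highest_into v e \<longleftrightarrow> e \<in> E \<and> snd e = v \<and>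
     (\<forall>f\<in>E. snd f = v \<longrightarrow> slope (fst e) (snd e) \<le> slope (fst f) (snd f))"

definition highest_below :: "real ^ 2 \<Rightarrow> (real ^ 2) \<times> (real ^ 2) \<Rightarrow> bool" where
  "highest_below w e \<longleftrightarrow> e \<in> E \<and> w $ 1 \<in> shadow e \<and>
     (\<forall>f\<in>E. w $ 1 \<in> shadow f \<and> height f (w $ 1) < w $ 2 \<longrightarrow> height f (w $ 1) \<le> height e (w $ 1)) \<and>
     height e (w $ 1) < w $ 2"

lemma highest_from_unique: "highest_from u e \<Longrightarrow> highest_from u f \<Longrightarrow> e = f"
  unfolding highest_from_def by (metis edge_eq_fst order_antisym)

lemma highest_into_unique: "highest_into v e \<Longrightarrow> highest_into v f \<Longrightarrow> e = f"
  unfolding highest_into_def by (metis edge_eq_snd order_antisym)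

lemma highest_below_unique: "highest_below w e \<Longrightarrow> highest_below w f \<Longrightarrow> e = f"
  unfolding highest_below_def by (metis no_crossing order_antisym)

text \<open>
  Let \<open>e\<close> and \<open>e'\<close> be consecutive edges leaving \<open>u\<close>, and let the wedge between them contain no
  vertex strictly to the left of \<open>t\<close>.  An edge \<open>f\<close> that is inside the wedge at \<open>x\<close> and goes on to
  \<open>t\<close> has nowhere to come from.  Followed to the left, it cannot start in the wedge, it cannot leave
  the wedge through \<open>e\<close> or \<open>e'\<close> without a crossing, it cannot start at \<open>u\<close> since \<open>e\<close> and \<open>e'\<close> are
  consecutive, and it cannot pass through \<open>u\<close>.
\<close>
lemma no_edge_enters_wedge:
  assumes e: "e \<in> E" "fst e = u" and e': "e' \<in> E" "fst e' = u"
    and above: "slope u (snd e) < slope u (snd e')"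
    and consecutive: "\<And>f. f \<in> E \<Longrightarrow> fst f = u \<Longrightarrow> slope u (snd e) < slope u (snd f) \<Longrightarrow> slope u (snd e') \<le> slope u (snd f)"
    and t: "u $ 1 < t" "t \<le> snd e $ 1" "t \<le> snd e' $ 1"
    and empty: "\<And>w. w \<in> V \<Longrightarrow> u $ 1 < w $ 1 \<Longrightarrow> w $ 1 < t \<Longrightarrow>
      height e (w $ 1) \<le> w $ 2 \<Longrightarrow> w $ 2 \<le> height e' (w $ 1) \<Longrightarrow> False"
    and f: "f \<in> E" "fst f $ 1 < x" "t \<le> snd f $ 1"
    and x: "u $ 1 < x" "x < t"
    and between: "height e x < height f x" "height f x < height e' x"
  shows False
proof -
  have no_meet: False if "fst f $ 1 \<le> s" "u $ 1 \<le> s" "s < x" "height f s < height e s \<or> height e' s < height f s" for s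
  proof -
    have "\<exists>y>s. y < x \<and> (height f y = height e y \<or> height f y = height e' y)"
      using that(4)
    proof
      assume "height f s < height e s"
      from heights_meet[OF this between(1)] show ?thesis using that(3) by force
    next
      assume "height e' s < height f s"
      from heights_meet[OF this between(2)] show ?thesis using that(3) by force
    qed
    then obtain y where y: "s < y" "y < x" "height f y = height e y \<or> height f y = height e' y"
      by blast
    have "y \<in> shadow f" "y \<in> shadow e" "y \<in> shadow e'"
      using y that t x f e e' by (auto simp: shadow_def)
    then show False
      using y(3) no_crossing[of f e y] no_crossing[of f e' y] e e' f between by auto
  qed
  show False
  proof (cases "u $ 1 < fst f $ 1")
    case True
    then have "height e (fst f $ 1) \<le> fst f $ 2" "fst f $ 2 \<le> height e' (fst f $ 1)"
      using no_meet[of "fst f $ 1"] f by force+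
    then show False
      using empty[of "fst f"] True f x ends_in_V by auto
  next
    case False
    show False
    proof (cases "fst f = u")
      case True
      have "slope u (snd e) < slope u (snd f)" "slope u (snd f) < slope u (snd e')"
        using between x True e e' by (auto simp: height_def)
      then show False using consecutive[OF f(1) True] by simp
    next
      case u: False
      have "height f (u $ 1) \<noteq> u $ 2"
      proof (cases "fst f $ 1 = u $ 1")
        case True
        then show ?thesis using u height_fst by (metis vec2_eqI)
      next
        case neq: False
        then show ?thesis
          using no_inner_vertex[of f u] False f t x e ends_in_V[of e] by (auto simp: shadow_def)
      qed
      then show False
        using no_meet[of "u $ 1"] False x e e' height_fst[of e] height_fst[of e'] by force
    qed
  qed
qed

text \<open>
  If \<open>e\<close> is not the highest edge leaving \<open>u\<close>, let \<open>e'\<close> be the next higher one and follow the wedge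
  between them to the right until it meets its first vertex \<open>w\<close>, at the latest an end of \<open>e\<close> or
  \<open>e'\<close>.  Up to there no other edge enters the wedge.  If \<open>w\<close> is the right end of \<open>e\<close>, no edge can
  arrive at \<open>w\<close> above \<open>e\<close>, and otherwise no edge can separate \<open>w\<close> from \<open>e\<close>.
\<close>
lemma edge_charged:
  assumes "e \<in> E"
  shows "\<exists>w\<in>V. highest_from w e \<or> highest_into w e \<or> highest_below w e"
proof (cases "highest_from (fst e) e")
  case True
  then show ?thesis using assms ends_in_V by blast
next
  case False
  define u v where "u = fst e" and "v = snd e"
  have V: "u \<in> V" "v \<in> V" using assms ends_in_V by (auto simp: u_def v_def)
  define F where "F = {f \<in> E. fst f = u \<and> slope u v < slope u (snd f)}"
  have "finite F" "F \<noteq> {}"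
    using False finite_E assms by (auto simp: F_def highest_from_def u_def v_def not_le)
  then obtain e' where e': "e' \<in> F" "\<And>f. f \<in> F \<Longrightarrow> slope u (snd e') \<le> slope u (snd f)"
    using arg_min_if_finite[of F "\<lambda>f. slope u (snd f)"] by (meson not_le)
  define v' where "v' = snd e'"
  have e'E: "e' \<in> E" "fst e' = u" "slope u v < slope u v'"
    using e' by (auto simp: F_def v'_def)
  have uv: "u $ 1 < v $ 1" "u $ 1 < v' $ 1"
    using left_right[OF assms] left_right[OF e'E(1)] e'E(2) by (simp_all add: u_def v_def v'_def)
  have hts: "height e x = u $ 2 + slope u v * (x - u $ 1)" "height e' x = u $ 2 + slope u v' * (x - u $ 1)" for x
    using e'E by (auto simp: height_def u_def v_def v'_def)
  have hv: "height e (v $ 1) = v $ 2" "height e' (v' $ 1) = v' $ 2"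
    using height_snd[OF left_right[OF assms]] height_snd[OF left_right[OF e'E(1)]]
    by (simp_all add: v_def v'_def)
  have e_less: "height e x < height e' x" if "u $ 1 < x" for x
    using that e'E by (simp add: hts)
  define W where "W = {w \<in> V. u $ 1 < w $ 1 \<and> w $ 1 \<le> v $ 1 \<and> w $ 1 \<le> v' $ 1 \<and>
     height e (w $ 1) \<le> w $ 2 \<and> w $ 2 \<le> height e' (w $ 1)}"
  have "finite W" using finite_V by (simp add: W_def)
  have vW: "v \<in> W" if "v $ 1 \<le> v' $ 1"
    using that V uv hv e_less[of "v $ 1"] by (simp add: W_def)
  have v'W: "v' \<in> W" if "v' $ 1 \<le> v $ 1"
    using that ends_in_V(2)[OF e'E(1)] uv hv e_less[of "v' $ 1"] by (simp add: W_def v'_def[symmetric])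
  have "W \<noteq> {}" using vW v'W by (meson linear empty_iff)
  \<comment> \<open>Several vertices of the wedge may have the least first coordinate \<open>t\<close>.  Taking the lowest
    of them ensures that \<open>e\<close> does not end at \<open>t\<close> unless \<open>w\<close> is its end.\<close>
  define t where "t = Min ((\<lambda>w. w $ 1) ` W)"
  define W' where "W' = {w \<in> W. w $ 1 = t}"
  have t: "\<And>w. w \<in> W \<Longrightarrow> t \<le> w $ 1" "t \<in> (\<lambda>w. w $ 1) ` W"
    using \<open>finite W\<close> \<open>W \<noteq> {}\<close> by (auto simp: t_def)
  then have "finite W'" "W' \<noteq> {}" using \<open>finite W\<close> by (auto simp: W'_def)
  then obtain w where w: "w \<in> W'" "\<And>z. z \<in> W' \<Longrightarrow> w $ 2 \<le> z $ 2"
    using arg_min_if_finite[of W' "\<lambda>w. w $ 2"] by (meson not_le)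
  then have wt: "w $ 1 = t" and wW: "w \<in> W" by (auto simp: W'_def)
  then have wV: "w \<in> V" "u $ 1 < t" "t \<le> v $ 1" "t \<le> v' $ 1" "height e t \<le> w $ 2" "w $ 2 \<le> height e' t"
    by (auto simp: W_def)
  \<comment> \<open>Below \<open>e'\<close> at \<open>t\<close> and above \<open>e\<close> just before \<open>t\<close>: by continuity such an \<open>f\<close> is inside the
    wedge just before \<open>t\<close>.\<close>
  have no_entry: False
    if f: "f \<in> E" "fst f $ 1 < t" "t \<le> snd f $ 1" and ft: "height f t < height e' t"
      and fx: "\<And>x. u $ 1 < x \<Longrightarrow> fst f $ 1 < x \<Longrightarrow> x < t \<Longrightarrow> x > s \<Longrightarrow> height e x < height f x" and "s < t" for f s
  proof -
    have "isCont (\<lambda>x. height e' x - height f x) t"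
      unfolding height_def by (intro continuous_intros)
    then have "\<forall>\<^sub>F x in at_left t. 0 < height e' x - height f x"
      using ft by (intro order_tendstoD(1)[of _ "height e' t - height f t"])
        (auto simp: isCont_def filterlim_at_split)
    moreover have "\<forall>\<^sub>F x in at_left t. max (max (u $ 1) (fst f $ 1)) s < x \<and> x < t"
      using eventually_at_left_real[of "max (max (u $ 1) (fst f $ 1)) s" t] wV f \<open>s < t\<close> by auto
    ultimately have "\<forall>\<^sub>F x in at_left t. 0 < height e' x - height f x \<and>
        max (max (u $ 1) (fst f $ 1)) s < x \<and> x < t"
      by (rule eventually_conj)
    then obtain x where x: "height f x < height e' x" "u $ 1 < x" "fst f $ 1 < x" "s < x" "x < t"
      by (auto dest!: eventually_happens simp: trivial_limit_at_left_real)
    show False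
    proof (rule no_edge_enters_wedge[of e u e' t f x])
      show "slope u (snd e') \<le> slope u (snd g)"
        if "g \<in> E" "fst g = u" "slope u (snd e) < slope u (snd g)" for g
        using that e'(2)[of g] by (simp add: F_def v_def)
      show False if "z \<in> V" "u $ 1 < z $ 1" "z $ 1 < t" "height e (z $ 1) \<le> z $ 2" "z $ 2 \<le> height e' (z $ 1)" for z
        using that t(1)[of z] wV by (auto simp: W_def)
    qed (use assms e'E wV f x fx[of x] in \<open>auto simp: u_def v_def v'_def\<close>)
  qed
  show ?thesis
  proof (cases "w = v")
    case True
    have "slope u v \<le> slope (fst f) (snd f)" if f: "f \<in> E" "snd f = v" for f
    proof (rule ccontr)
      assume neg: "\<not> ?thesis"
      have lt: "height e x < height f x" if "x < t" for x
      proof -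
        have "(slope u v - slope (fst f) (snd f)) * (v $ 1 - x) > 0"
          using neg that True wt by (intro mult_pos_pos) auto
        then show ?thesis
          using height_from_snd[OF assms, of x] height_from_snd[OF f(1), of x] f(2)
          by (simp add: u_def v_def algebra_simps)
      qed
      have "height f t < height e' t"
        using height_snd[of f] left_right[of f] f True wt hv e_less[of t] wV by auto
      then show False
        using no_entry[of f "u $ 1"] f lt left_right[of f] True wt wV by auto
    qed
    then have "highest_into v e"
      using assms by (simp add: highest_into_def u_def v_def)
    then show ?thesis using V by blast
  next
    case False
    have "t < v $ 1"
    proof (rule ccontr)
      assume "\<not> t < v $ 1"
      then have "t = v $ 1" using wV by simp
      moreover have "v \<in> W" using vW wV \<open>t = v $ 1\<close> by simp
      ultimately have "w $ 2 \<le> v $ 2" using w by (simp add: W'_def)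
      then have "w $ 2 = v $ 2" using wV hv \<open>t = v $ 1\<close> by simp
      then show False using False wt \<open>t = v $ 1\<close> by (simp add: vec2_eqI)
    qed
    then have te: "t \<in> shadow e" using wV by (simp add: shadow_def u_def v_def)
    then have we: "height e t < w $ 2"
      using no_inner_vertex[of e w] assms wV wt by force
    have "height f t \<le> height e t" if f: "f \<in> E" "t \<in> shadow f" "height f t < w $ 2" for f
    proof (rule ccontr)
      assume neg: "\<not> ?thesis"
      have "isCont (\<lambda>x. height f x - height e x) t"
        unfolding height_def by (intro continuous_intros)
      then have "\<forall>\<^sub>F x in at_left t. 0 < height f x - height e x"
        using neg by (intro order_tendstoD(1)[of _ "height f t - height e t"])
          (auto simp: isCont_def filterlim_at_split)
      then obtain s where "s < t" "\<And>x. s < x \<Longrightarrow> x < t \<Longrightarrow> height e x < height f x"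
        unfolding eventually_at_left_field by auto
      then show False
        using no_entry[of f s] f wV by (auto simp: shadow_def)
    qed
    then have "highest_below w e"
      using assms we te wt by (simp add: highest_below_def)
    then show ?thesis using wV by blast
  qed
qed

theorem card_edges_le: "card E \<le> 3 * card V"
proof -
  let ?B = "\<lambda>R. {e. \<exists>w\<in>V. R w e}"
  have "E \<subseteq> ?B highest_from \<union> ?B highest_into \<union> ?B highest_below"
    using edge_charged by blast
  moreover have from_le: "card (?B highest_from) \<le> card V" "finite (?B highest_from)"
    by (rule card_related_le[OF finite_V]; metis highest_from_unique)+
  moreover have into_le: "card (?B highest_into) \<le> card V" "finite (?B highest_into)"
    by (rule card_related_le[OF finite_V]; metis highest_into_unique)+
  moreover have below_le: "card (?B highest_below) \<le> card V" "finite (?B highest_below)"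
    by (rule card_related_le[OF finite_V]; metis highest_below_unique)+
  ultimately have "card E \<le> card (?B highest_from \<union> ?B highest_into \<union> ?B highest_below)"
    by (intro card_mono finite_UnI)
  also have "\<dots> \<le> card (?B highest_from) + card (?B highest_into) + card (?B highest_below)"
    by (meson card_Un_le add_le_mono1 order_trans)
  also have "\<dots> \<le> card V + card V + card V"
    using from_le into_le below_le by (intro add_mono)
  finally show ?thesis by simp
qed

end

section \<open>The crossing lemma\<close>

lemma card_colourings_fixed:
  fixes m :: nat
  assumes "finite V" "B \<subseteq> V" "m > 0"
  shows "card {c \<in> V \<rightarrow>\<^sub>E {..<m}. \<forall>v\<in>B. c v = 0} * m ^ card B = m ^ card V"
proof -
  have "{c \<in> V \<rightarrow>\<^sub>E {..<m}. \<forall>v\<in>B. c v = 0} = (\<Pi>\<^sub>E v\<in>V. if v \<in> B then {0} else {..<m})"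
  proof (intro set_eqI iffI)
    fix c assume "c \<in> {c \<in> V \<rightarrow>\<^sub>E {..<m}. \<forall>v\<in>B. c v = 0}"
    then show "c \<in> (\<Pi>\<^sub>E v\<in>V. if v \<in> B then {0} else {..<m})" by (simp add: PiE_iff)
  next
    fix c assume c: "c \<in> (\<Pi>\<^sub>E v\<in>V. if v \<in> B then {0} else {..<m})"
    then have "c v \<in> (if v \<in> B then {0} else {..<m})" if "v \<in> V" for v
      using that by (simp add: PiE_iff)
    then have "c v < m \<and> (v \<in> B \<longrightarrow> c v = 0)" if "v \<in> V" for v
      using that \<open>m > 0\<close> by (metis lessThan_iff singletonD)
    then show "c \<in> {c \<in> V \<rightarrow>\<^sub>E {..<m}. \<forall>v\<in>B. c v = 0}"
      using c \<open>B \<subseteq> V\<close> by (auto simp: PiE_iff)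
  qed
  then have "card {c \<in> V \<rightarrow>\<^sub>E {..<m}. \<forall>v\<in>B. c v = 0} = (\<Prod>v\<in>V. if v \<in> B then 1 else m)"
    using assms(1) by (simp add: card_PiE if_distrib cong: if_cong)
  also have "\<dots> = m ^ card (V - B)"
    using assms by (simp add: prod.If_cases Diff_eq)
  finally show ?thesis
    using assms card_mono[OF assms(1,2)] by (simp add: card_Diff_subset finite_subset flip: power_add)
qed

text \<open>
  Colouring \<open>V\<close> uniformly with \<open>m\<close> colours, \<open>d\<close> given vertices all receive colour 0 with probability
  \<open>1 / m ^ d\<close>.  This is linearity of expectation with denominators cleared.
\<close>
lemma sum_colourings_zero_class:
  fixes m :: nat
  assumes "finite V" "finite T" "m > 0"
    and "\<And>x. x \<in> T \<Longrightarrow> g x \<subseteq> V \<and> card (g x) = d"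
  shows "(\<Sum>c\<in>V \<rightarrow>\<^sub>E {..<m}. card {x \<in> T. \<forall>v\<in>g x. c v = 0}) * m ^ d = card T * m ^ card V"
proof -
  let ?\<Omega> = "V \<rightarrow>\<^sub>E {..<m}"
  have "finite ?\<Omega>" using assms by (simp add: finite_PiE)
  then have "(\<Sum>c\<in>?\<Omega>. card {x \<in> T. \<forall>v\<in>g x. c v = 0}) = (\<Sum>x\<in>T. card {c \<in> ?\<Omega>. \<forall>v\<in>g x. c v = 0})"
    using assms(2) by (rule sum_multicount_gen) simp
  then have "(\<Sum>c\<in>?\<Omega>. card {x \<in> T. \<forall>v\<in>g x. c v = 0}) * m ^ d =
      (\<Sum>x\<in>T. card {c \<in> ?\<Omega>. \<forall>v\<in>g x. c v = 0} * m ^ card (g x))"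
    using assms(4) by (simp add: sum_distrib_right)
  also have "\<dots> = (\<Sum>x\<in>T. m ^ card V)"
    using card_colourings_fixed[OF assms(1) _ assms(3)] assms(4) by (intro sum.cong) auto
  finally show ?thesis by simp
qed

text \<open>
  Ordered pairs: each unordered crossing is counted twice, which costs only a constant factor.
\<close>
definition crossings where
  "crossings E = {(e, f). e \<in> E \<and> f \<in> E \<and> crosses e f}"

context segment_graph
begin

lemma finite_crossings: "finite (crossings E)"
  by (rule finite_subset[of _ "E \<times> E"]) (auto simp: crossings_def finite_E)

lemma subgraph:
  assumes "A \<subseteq> V" "F \<subseteq> E" "F \<subseteq> A \<times> A"
  shows "segment_graph A F"
  using assms finite_V finite_subset left_right no_inner_vertex
  by unfold_locales blast+

text \<open>
  Deleting every crossed edge leaves a graph without crossings, and a crossed edge is the first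
  component of some ordered crossing pair.
\<close>
theorem card_edges_le_crossings: "card E \<le> 3 * card V + card (crossings E)"
proof -
  let ?F = "E - fst ` crossings E"
  interpret F: segment_graph V ?F
    using E_sub by (intro subgraph) auto
  interpret F: plane_segment_graph V ?F
  proof
    fix e f x
    assume ef: "e \<in> ?F" "f \<in> ?F" "x \<in> shadow e" "x \<in> shadow f" "height e x = height f x"
    show "e = f"
    proof (rule ccontr)
      assume "e \<noteq> f"
      then have "(e, f) \<in> crossings E"
        using ef by (auto simp: crossings_def crosses_def)
      then have "e \<in> fst ` crossings E" by (rule image_eqI[rotated]) simp
      then show False using ef by blast
    qed
  qed
  have "card E \<le> card (?F \<union> fst ` crossings E)"
    using finite_E finite_crossings by (intro card_mono) auto
  also have "\<dots> \<le> card ?F + card (fst ` crossings E)"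
    by (rule card_Un_le)
  also have "\<dots> \<le> 3 * card V + card (crossings E)"
    using F.card_edges_le card_image_le[OF finite_crossings] by (rule add_mono)
  finally show ?thesis .
qed

text \<open>
  The vertices of colour 0 in a random colouring span a subgraph to which the previous bound applies.
  A vertex, an edge and a crossing survive with probability \<open>1 / m\<close>, \<open>1 / m ^ 2\<close> and \<open>1 / m ^ 4\<close>, so
  that averaging over all colourings shrinks the vertex term the least and the crossing term the most.
\<close>
theorem sampled_crossing_bound:
  assumes "m > 0"
  shows "card E * m ^ 2 \<le> 3 * card V * m ^ 3 + card (crossings E)"
proof -
  let ?\<Omega> = "V \<rightarrow>\<^sub>E {..<m}"
  let ?V = "\<lambda>c. {v \<in> V. \<forall>w\<in>{v}. c w = (0::nat)}"
  let ?E = "\<lambda>c. {e \<in> E. \<forall>w\<in>{fst e, snd e}. c w = (0::nat)}"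
  let ?X = "\<lambda>c. {x \<in> crossings E. \<forall>w\<in>{fst (fst x), snd (fst x), fst (snd x), snd (snd x)}. c w = (0::nat)}"
  have sub: "card (?E c) \<le> 3 * card (?V c) + card (?X c)" for c
  proof -
    interpret c: segment_graph "?V c" "?E c"
      using E_sub by (intro subgraph) auto
    have "crossings (?E c) = ?X c"
      by (auto simp: crossings_def)
    then show ?thesis using c.card_edges_le_crossings by simp
  qed
  have "(\<Sum>c\<in>?\<Omega>. card (?E c)) \<le> 3 * (\<Sum>c\<in>?\<Omega>. card (?V c)) + (\<Sum>c\<in>?\<Omega>. card (?X c))"
    using sum_mono[OF sub] by (simp add: sum.distrib sum_distrib_left)
  then have "(\<Sum>c\<in>?\<Omega>. card (?E c)) * m ^ 4 \<le>
      (3 * (\<Sum>c\<in>?\<Omega>. card (?V c)) + (\<Sum>c\<in>?\<Omega>. card (?X c))) * m ^ 4"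
    by (rule mult_le_mono1)
  also have "\<dots> = 3 * ((\<Sum>c\<in>?\<Omega>. card (?V c)) * m ^ 1) * m ^ 3 + (\<Sum>c\<in>?\<Omega>. card (?X c)) * m ^ 4"
    by (simp add: power_numeral_reduce algebra_simps)
  also have "(\<Sum>c\<in>?\<Omega>. card (?E c)) * m ^ 4 = ((\<Sum>c\<in>?\<Omega>. card (?E c)) * m ^ 2) * m ^ 2"
    by (simp add: power_numeral_reduce algebra_simps)
  also have "(\<Sum>c\<in>?\<Omega>. card (?V c)) * m ^ 1 = card V * m ^ card V"
    using finite_V assms by (intro sum_colourings_zero_class) auto
  also have "(\<Sum>c\<in>?\<Omega>. card (?E c)) * m ^ 2 = card E * m ^ card V"
  proof (intro sum_colourings_zero_class)
    show "{fst e, snd e} \<subseteq> V \<and> card {fst e, snd e} = 2" if "e \<in> E" for e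
    proof -
      have "fst e \<noteq> snd e" using left_right[OF that] by force
      then show ?thesis using ends_in_V[OF that] by simp
    qed
  qed (use finite_V finite_E assms in auto)
  also have "(\<Sum>c\<in>?\<Omega>. card (?X c)) * m ^ 4 = card (crossings E) * m ^ card V"
  proof (intro sum_colourings_zero_class)
    show "{fst (fst x), snd (fst x), fst (snd x), snd (snd x)} \<subseteq> V \<and>
        card {fst (fst x), snd (fst x), fst (snd x), snd (snd x)} = 4" if "x \<in> crossings E" for x
    proof -
      have "fst x \<in> E" "snd x \<in> E" "crosses (fst x) (snd x)"
        using that by (auto simp: crossings_def)
      then show ?thesis using crossing_ends_distinct ends_in_V by blast
    qed
  qed (use finite_V finite_crossings assms in auto)
  finally have "(card E * m ^ 2) * m ^ card V \<le> (3 * card V * m ^ 3 + card (crossings E)) * m ^ card V"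
    by (simp add: algebra_simps)
  then show ?thesis using assms by simp
qed

text \<open>
  The number of colours is chosen so that the vertex term takes up at most half of the number of edges.
\<close>
theorem crossing_lemma:
  assumes "6 * card V \<le> card E"
  shows "card E ^ 3 \<le> 288 * card V ^ 2 * card (crossings E)"
proof (cases "card V = 0")
  case True
  then show ?thesis using finite_V E_sub by simp
next
  case False
  define m where "m = card E div (6 * card V)"
  have "m > 0" using assms False by (simp add: m_def div_greater_zero_iff)
  have upper: "6 * card V * m \<le> card E"
    by (simp add: m_def)
  have "card E < 6 * card V * (m + 1)"
    using False dividend_less_times_div[of "6 * card V" "card E"] by (simp add: m_def)
  also have "\<dots> \<le> 12 * card V * m"
    using \<open>m > 0\<close> by simp
  finally have lower: "card E \<le> 12 * card V * m" by simp
  have "2 * (card E * m ^ 2) \<le> (6 * card V * m) * m ^ 2 + 2 * card (crossings E)"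
    using sampled_crossing_bound[OF \<open>m > 0\<close>] by (simp add: power_numeral_reduce algebra_simps)
  also have "\<dots> \<le> card E * m ^ 2 + 2 * card (crossings E)"
    using upper by (intro add_right_mono mult_right_mono) auto
  finally have main: "card E * m ^ 2 \<le> 2 * card (crossings E)" by simp
  have "card E ^ 3 = card E * card E ^ 2" by (simp add: power_numeral_reduce)
  also have "\<dots> \<le> card E * (12 * card V * m) ^ 2"
    using lower by (intro mult_left_mono power_mono) auto
  also have "\<dots> = 144 * card V ^ 2 * (card E * m ^ 2)"
    by (simp add: power_mult_distrib)
  also have "\<dots> \<le> 144 * card V ^ 2 * (2 * card (crossings E))"
    using main by (intro mult_left_mono) auto
  finally show ?thesis by simp
qed

end

section \<open>Lines rich in points\<close>

text \<open>
  Lines that are not vertical are stored as slope and intercept; vertical lines do not arise from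
  pairs of points with distinct first coordinates.
\<close>
definition graph_line :: "real \<times> real \<Rightarrow> (real ^ 2) set" where
  "graph_line l = {p. p $ 2 = fst l * p $ 1 + snd l}"

definition consecutive_pairs :: "(real ^ 2) set \<Rightarrow> ((real ^ 2) \<times> (real ^ 2)) set" where
  "consecutive_pairs P = {(u, v). u \<in> P \<and> v \<in> P \<and> u $ 1 < v $ 1 \<and> (\<forall>w\<in>P. \<not> (u $ 1 < w $ 1 \<and> w $ 1 < v $ 1))}"

lemma card_consecutive_pairs_ge:
  assumes "finite P" "inj_on (\<lambda>p. p $ 1) P"
  shows "card P \<le> card (consecutive_pairs P) + 1"
proof (cases "P = {}")
  case False
  have "finite (consecutive_pairs P)"
    using assms(1) by (auto simp: consecutive_pairs_def intro: finite_subset[of _ "P \<times> P"])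
  obtain z where z: "z \<in> P" "\<And>w. w \<in> P \<Longrightarrow> w $ 1 \<le> z $ 1"
    using arg_min_if_finite[OF assms(1) False, of "\<lambda>p. - p $ 1"] by (meson neg_le_iff_le not_le)
  have "P - {z} \<subseteq> fst ` consecutive_pairs P"
  proof
    fix u assume u: "u \<in> P - {z}"
    let ?R = "{w \<in> P. u $ 1 < w $ 1}"
    have "finite ?R" using assms(1) by simp
    have "u $ 1 \<noteq> z $ 1" using u z assms(2) by (auto dest: inj_onD)
    then have "?R \<noteq> {}" using z u by force
    then obtain v where "v \<in> ?R" "\<And>w. w \<in> ?R \<Longrightarrow> v $ 1 \<le> w $ 1"
      using arg_min_if_finite[of ?R "\<lambda>p. p $ 1"] \<open>finite ?R\<close> \<open>?R \<noteq> {}\<close> by (meson not_le)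
    then have "(u, v) \<in> consecutive_pairs P" using u by (force simp: consecutive_pairs_def)
    then show "u \<in> fst ` consecutive_pairs P" by force
  qed
  then have "card (P - {z}) \<le> card (consecutive_pairs P)"
    using surj_card_le[OF \<open>finite (consecutive_pairs P)\<close>] by blast
  then show ?thesis using z assms(1) by simp
qed simp

lemma inj_on_graph_line: "inj_on (\<lambda>p. p $ 1) (graph_line l)"
  by (auto simp: graph_line_def inj_on_def intro: vec2_eqI)

lemma height_graph_line:
  assumes "fst e \<in> graph_line l" "snd e \<in> graph_line l" "fst e $ 1 < snd e $ 1"
  shows "height e x = fst l * x + snd l"
proof -
  have "slope (fst e) (snd e) = fst l"
    using assms by (simp add: slope_def graph_line_def field_simps)
  then show ?thesis
    using assms by (simp add: height_def graph_line_def algebra_simps)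
qed

lemma graph_line_eqI:
  fixes l l' :: "real \<times> real"
  assumes "fst l * x + snd l = fst l' * x + snd l'" "fst l * y + snd l = fst l' * y + snd l'" "x \<noteq> y"
  shows "l = l'"
proof -
  have "(fst l - fst l') * (x - y) = 0" using assms(1,2) by (simp add: algebra_simps)
  then show ?thesis using assms by (simp add: prod_eq_iff)
qed

text \<open>
  Szekely's argument.  Join consecutive points of \<open>S\<close> on every line of \<open>L\<close>.  A line with at least
  \<open>k\<close> points carries at least \<open>k - 1\<close> edges, while two lines meet at most once, so that there are at
  most as many crossings as pairs of lines.  The crossing lemma compares these two counts; the term
  \<open>12 * card S * k ^ 2\<close> covers the case of too few edges for it to apply.
\<close>
theorem szemeredi_trotter_rich_lines:
  fixes S :: "(real ^ 2) set" and L :: "(real \<times> real) set"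
  assumes "finite S" "finite L" "k \<ge> 2"
    and rich: "\<And>l. l \<in> L \<Longrightarrow> k \<le> card (S \<inter> graph_line l)"
  shows "card L * k ^ 3 \<le> 2304 * card S ^ 2 + 12 * card S * k ^ 2"
proof -
  let ?E = "\<lambda>l. consecutive_pairs (S \<inter> graph_line l)"
  define E where "E = (\<Union>l\<in>L. ?E l)"
  have ends: "fst e \<in> S" "snd e \<in> S" "fst e \<in> graph_line l" "snd e \<in> graph_line l" "fst e $ 1 < snd e $ 1"
    if "e \<in> ?E l" for e l
    using that by (auto simp: consecutive_pairs_def)
  have hts: "height e x = fst l * x + snd l" if "e \<in> ?E l" for e l x
    using ends[OF that] height_graph_line by blast
  interpret segment_graph S E
  proof
    show "E \<subseteq> S \<times> S" by (auto simp: E_def consecutive_pairs_def)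
    show "height e (w $ 1) \<noteq> w $ 2" if e: "e \<in> E" "w \<in> S" "w $ 1 \<in> shadow e" for e w
    proof
      assume eq: "height e (w $ 1) = w $ 2"
      obtain l where l: "l \<in> L" "e \<in> ?E l" using e(1) by (auto simp: E_def)
      then have "w \<in> S \<inter> graph_line l" using eq hts e(2) by (simp add: graph_line_def)
      then show False using l(2) e(3) by (auto simp: consecutive_pairs_def shadow_def)
    qed
    show "fst e $ 1 < snd e $ 1" if "e \<in> E" for e
      using that ends(5) unfolding E_def by blast
  qed (rule assms(1))
  have line_unique: "l = l'" if "e \<in> ?E l" "e \<in> ?E l'" for e l l'
    using graph_line_eqI[of l "fst e $ 1" l' "snd e $ 1"] hts that ends(5)[OF that(1)]
    by (metis less_irrefl)
  have finE: "finite (?E l)" for l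
    using assms(1) by (auto simp: consecutive_pairs_def intro: finite_subset[of _ "S \<times> S"])
  have many_edges: "card L * (k - 1) \<le> card E"
  proof -
    have "(\<Sum>l\<in>L. k - 1) \<le> (\<Sum>l\<in>L. card (?E l))"
    proof (rule sum_mono)
      fix l assume "l \<in> L"
      then show "k - 1 \<le> card (?E l)"
        using rich[of l] card_consecutive_pairs_ge[of "S \<inter> graph_line l"] assms(1)
          inj_on_subset[OF inj_on_graph_line[of l], of "S \<inter> graph_line l"] by auto
    qed
    also have "\<dots> = card E"
      unfolding E_def using assms(2) finE line_unique
      by (intro card_UN_disjoint[symmetric]) auto
    finally show ?thesis by simp
  qed
  have few_crossings: "card (crossings E) \<le> card L ^ 2"
  proof -
    \<comment> \<open>A crossing is determined by the lines of its two edges: these lines meet in one point only,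
      and a line has at most one edge over a given first coordinate.\<close>
    define R where "R = (\<lambda>(e, f) (l, l'). l \<in> L \<and> l' \<in> L \<and> e \<in> ?E l \<and> f \<in> ?E l')"
    have same: "e = e'" if "e \<in> ?E l" "e' \<in> ?E l" "x \<in> shadow e" "x \<in> shadow e'" "l \<in> L" for e e' l x
      using edge_eqI[of e e' x] that hts by (auto simp: E_def fun_eq_iff)
    have ex: "\<exists>p. p \<in> L \<times> L \<and> R q p" if "q \<in> crossings E" for q
      using that by (auto simp: crossings_def E_def R_def)
    have inj: "q = q'" if q: "q \<in> crossings E" "q' \<in> crossings E" and R: "R q p" "R q' p" for q q' p
    proof -
      obtain e f e' f' l l' where [simp]: "q = (e, f)" "q' = (e', f')" "p = (l, l')"
        by (metis surj_pair)
      have ll: "l \<in> L" "l' \<in> L" "e \<in> ?E l" "e' \<in> ?E l" "f \<in> ?E l'" "f' \<in> ?E l'"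
        using R by (auto simp: R_def)
      obtain x where x: "x \<in> shadow e" "x \<in> shadow f" "height e x = height f x" "e \<noteq> f"
        using q(1) by (auto simp: crossings_def crosses_def)
      obtain y where y: "y \<in> shadow e'" "y \<in> shadow f'" "height e' y = height f' y"
        using q(2) by (auto simp: crossings_def crosses_def)
      have "l \<noteq> l'" using same[of e l f x] ll x by auto
      then have "x = y"
        using graph_line_eqI[of l x l' y] x(3) y(3) hts ll by auto
      then show ?thesis using same[of e l e' x] same[of f l' f' x] ll x y by simp
    qed
    have "card (crossings E) \<le> card (L \<times> L)"
    proof (rule card_le_if_inj_on_rel[of "L \<times> L" "crossings E" R])
      show "finite (L \<times> L)" using assms(2) by simp
      show "\<exists>p. p \<in> L \<times> L \<and> R q p" if "q \<in> crossings E" for q using that by (rule ex)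
      show "q = q'" if "q \<in> crossings E" "q' \<in> crossings E" "p \<in> L \<times> L" "R q p" "R q' p" for q q' p
        using that(1,2,4,5) by (rule inj)
    qed
    then show ?thesis by (simp add: card_cartesian_product power2_eq_square)
  qed
  have "card L * k \<le> card L * (2 * (k - 1))"
    using \<open>k \<ge> 2\<close> by (intro mult_left_mono) auto
  also have "\<dots> = 2 * (card L * (k - 1))"
    by (rule mult.left_commute)
  also have "\<dots> \<le> 2 * card E"
    using many_edges by (rule mult_left_mono) simp
  finally have Lk: "card L * k \<le> 2 * card E" .
  show ?thesis
  proof (cases "6 * card S \<le> card E")
    case True
    have "(card L * k ^ 3) * card L ^ 2 = (card L * k) ^ 3"
      by (simp add: power_mult_distrib power_numeral_reduce)
    also have "\<dots> \<le> (2 * card E) ^ 3"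
      using Lk by (rule power_mono) simp
    also have "\<dots> \<le> 8 * (288 * card S ^ 2 * card (crossings E))"
      using crossing_lemma[OF True] by (simp add: power_mult_distrib mult_ac)
    also have "\<dots> \<le> 2304 * card S ^ 2 * card L ^ 2"
      using few_crossings by simp
    finally have "card L * k ^ 3 \<le> 2304 * card S ^ 2" by (cases "card L = 0") simp_all
    then show ?thesis by simp
  next
    case False
    then have "card L * k \<le> 12 * card S" using Lk by simp
    then have "(card L * k) * k ^ 2 \<le> 12 * card S * k ^ 2" by (rule mult_le_mono1)
    moreover have "(card L * k) * k ^ 2 = card L * k ^ 3"
      by (simp add: power_numeral_reduce)
    ultimately show ?thesis by linarith
  qed
qed

section \<open>Collinear triples\<close>

lemma straight_line_graph_line: "straight_line (graph_line l)"
proof -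
  define a :: "real ^ 2" where "a = vector [- fst l, 1]"
  have "graph_line l = {p. a \<bullet> p = snd l}"
    by (auto simp: graph_line_def a_def inner_vec_def sum_2)
  moreover have "a \<noteq> 0"
    by (auto simp: a_def vec_eq_iff forall_2)
  ultimately show ?thesis
    by (simp add: straight_line_def affine_hyperplane aff_dim_hyperplane)
qed

definition line_at :: "real \<Rightarrow> real ^ 2 \<Rightarrow> real \<times> real" where
  "line_at s q = (s, q $ 2 - s * q $ 1)"

definition proper_pairs :: "(real ^ 2) set \<Rightarrow> ((real ^ 2) \<times> (real ^ 2)) set" where
  "proper_pairs S = {(p, p'). p \<in> S \<and> p' \<in> S \<and> p $ 1 \<noteq> p' $ 1}"

text \<open>
  Summed over the pairs \<open>e\<close> in \<open>proper_pairs S\<close>, this counts the collinear triples of \<open>S\<close> whose first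
  two points differ in the first coordinate.
\<close>
definition richness :: "(real ^ 2) set \<Rightarrow> (real ^ 2) \<times> (real ^ 2) \<Rightarrow> nat" where
  "richness S e = card (S \<inter> graph_line (line_at (slope (fst e) (snd e)) (fst e)))"

lemma in_line_at [simp]: "q \<in> graph_line (line_at s q)"
  by (simp add: graph_line_def line_at_def)

lemma in_line_at_slope: "q' \<in> graph_line (line_at (slope q q') q)" if "q $ 1 \<noteq> q' $ 1"
proof -
  have "slope q q' * (q $ 1 - q' $ 1) = q $ 2 - q' $ 2"
    using that by (simp add: slope_def)
  then show ?thesis by (simp add: graph_line_def line_at_def algebra_simps)
qed

lemma finite_proper_pairs: "finite (proper_pairs S)" if "finite S"
  by (rule finite_subset[of _ "S \<times> S"]) (use that in \<open>auto simp: proper_pairs_def\<close>)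

text \<open>
  Partial summation for third moments: it turns the sum of \<open>n l ^ 3\<close> over lines \<open>l\<close> with \<open>n l \<ge> 2\<close>
  points into a sum over \<open>k\<close> of \<open>k ^ 2\<close> times the number of \<open>k\<close>-rich lines.  It starts at 2
  because the number of \<open>k\<close>-rich lines is bounded only for \<open>k \<ge> 2\<close>.
\<close>
lemma cube_le_sum_squares: "n ^ 3 \<le> 4 * (\<Sum>k = 2..n. k ^ 2)" if "n \<ge> 2" for n :: nat
  using that
proof (induction n rule: dec_induct)
  case (step n)
  then show ?case by (simp add: power_numeral_reduce algebra_simps)
qed simp

lemma sum_inverse_le_ln: "(\<Sum>k = 2..n. 1 / real k) \<le> ln (real n)" if "n \<ge> 1"
  using that
proof (induction n rule: dec_induct)
  case (step n)
  have "ln (real n) - ln (real (Suc n)) \<le> (real n - real (Suc n)) / real (Suc n)"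
    using step.hyps by (intro ln_diff_le) auto
  then show ?case using step by simp
qed simp

text \<open>
  A line with \<open>n\<close> points contributes at most \<open>n ^ 3\<close>.  As \<open>k\<close>-rich lines exist only for
  \<open>k \<le> C * sqrt N\<close>, the term \<open>N ^ 2 / k ^ 3\<close> dominates the term \<open>N / k\<close> in the bound for their number,
  and \<open>k ^ 2\<close> times this number is at most a constant times \<open>N ^ 2 / k\<close>.  The harmonic sum over \<open>k\<close>
  is the source of the logarithm.
\<close>
theorem collinear_triples_bound:
  fixes S :: "(real ^ 2) set"
  assumes "finite S" "S \<noteq> {}" "C > 0"
    and lines: "\<And>L. straight_line L \<Longrightarrow> real (card (S \<inter> L)) \<le> C * sqrt (real (card S))"
  shows "real (\<Sum>e\<in>proper_pairs S. richness S e) \<le>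
    4 * (2304 + 12 * C\<^sup>2) * real (card S) ^ 2 * ln (real (card S))"
proof -
  define N where "N = card S"
  \<comment> \<open>The summand \<open>12 * C\<^sup>2\<close> absorbs the term \<open>12 * N * k ^ 2\<close>, as \<open>k ^ 2 \<le> C\<^sup>2 * N\<close> for every \<open>k\<close>
    for which there is a \<open>k\<close>-rich line.\<close>
  define K where "K = 2304 + 12 * C\<^sup>2"
  define line where "line = (\<lambda>e. line_at (slope (fst e) (snd e)) (fst e))"
  define L where "L = line ` proper_pairs S"
  define n where "n = (\<lambda>l. card (S \<inter> graph_line l))"
  define rich where "rich = (\<lambda>k. {l \<in> L. k \<le> n l})"
  have "N \<ge> 1" using assms by (simp add: N_def Suc_le_eq card_gt_0_iff)
  have "finite L" using assms by (simp add: L_def finite_proper_pairs)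
  have nN: "n l \<le> N" for l
    using assms(1) by (auto simp: n_def N_def intro: card_mono)
  have ends: "fst e \<in> S \<inter> graph_line (line e)" "snd e \<in> S \<inter> graph_line (line e)" if "e \<in> proper_pairs S" for e
    using that in_line_at_slope by (auto simp: proper_pairs_def line_def)
  have n2: "n l \<ge> 2" if "l \<in> L" for l
  proof -
    obtain e where e: "e \<in> proper_pairs S" "l = line e" using \<open>l \<in> L\<close> by (auto simp: L_def)
    then have "{fst e, snd e} \<subseteq> S \<inter> graph_line l" "fst e \<noteq> snd e"
      using ends by (auto simp: proper_pairs_def)
    then show ?thesis
      using card_mono[of "S \<inter> graph_line l" "{fst e, snd e}"] assms(1) by (simp add: n_def)
  qed
  have "(\<Sum>e\<in>proper_pairs S. richness S e) = (\<Sum>l\<in>L. \<Sum>e | e \<in> proper_pairs S \<and> line e = l. richness S e)"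
    unfolding L_def using assms(1) by (intro sum.image_gen finite_proper_pairs)
  also have "\<dots> \<le> (\<Sum>l\<in>L. n l ^ 3)"
  proof (rule sum_mono)
    fix l assume "l \<in> L"
    let ?P = "{e \<in> proper_pairs S. line e = l}"
    have "?P \<subseteq> (S \<inter> graph_line l) \<times> (S \<inter> graph_line l)"
      using ends by (auto simp: mem_Times_iff)
    then have "card ?P \<le> n l * n l"
      using card_mono[of "(S \<inter> graph_line l) \<times> (S \<inter> graph_line l)" ?P] assms(1)
      by (simp add: card_cartesian_product n_def)
    moreover have "(\<Sum>e\<in>?P. richness S e) = (\<Sum>e\<in>?P. n l)"
      by (rule sum.cong) (auto simp: richness_def n_def line_def)
    ultimately show "(\<Sum>e\<in>?P. richness S e) \<le> n l ^ 3"
      by (simp add: power3_eq_cube)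
  qed
  also have "\<dots> \<le> (\<Sum>l\<in>L. 4 * (\<Sum>k = 2..n l. k ^ 2))"
    by (intro sum_mono cube_le_sum_squares n2)
  also have "\<dots> = 4 * (\<Sum>l\<in>L. \<Sum>k = 2..N. if k \<le> n l then k ^ 2 else 0)"
  proof -
    have "(\<Sum>k = 2..n l. k ^ 2) = (\<Sum>k = 2..N. if k \<le> n l then k ^ 2 else 0)" for l
      using nN[of l] by (intro sum.mono_neutral_cong_left) auto
    then show ?thesis by (simp add: sum_distrib_left)
  qed
  also have "\<dots> = 4 * (\<Sum>k = 2..N. \<Sum>l\<in>L. if k \<le> n l then k ^ 2 else 0)"
    by (subst sum.swap) simp
  also have "\<dots> = 4 * (\<Sum>k = 2..N. card (rich k) * k ^ 2)"
    using \<open>finite L\<close> by (simp add: sum.If_cases rich_def Int_def)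
  finally have "real (\<Sum>e\<in>proper_pairs S. richness S e) \<le> real (4 * (\<Sum>k = 2..N. card (rich k) * k ^ 2))"
    by (simp only: of_nat_le_iff)
  also have "\<dots> = 4 * (\<Sum>k = 2..N. real (card (rich k)) * real k ^ 2)"
    by simp
  also have "\<dots> \<le> 4 * (\<Sum>k = 2..N. K * real N ^ 2 * (1 / real k))"
  proof (intro mult_left_mono sum_mono)
    fix k assume k: "k \<in> {2..N}"
    have "real (card (rich k)) * real k ^ 3 \<le> K * real N ^ 2"
    proof (cases "rich k = {}")
      case True
      then show ?thesis by (simp add: K_def)
    next
      case False
      then obtain l where "k \<le> n l" by (auto simp: rich_def)
      then have "real k \<le> C * sqrt (real N)"
        using lines[OF straight_line_graph_line, of l] by (simp add: n_def N_def)
      then have "real k ^ 2 \<le> (C * sqrt (real N)) ^ 2"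
        by (rule power_mono) simp
      then have k2: "real k ^ 2 \<le> C\<^sup>2 * real N"
        by (simp add: power_mult_distrib)
      have "card (rich k) * k ^ 3 \<le> 2304 * N ^ 2 + 12 * N * k ^ 2"
        unfolding N_def using assms(1) \<open>finite L\<close> k
        by (intro szemeredi_trotter_rich_lines) (auto simp: rich_def n_def)
      then have "real (card (rich k) * k ^ 3) \<le> real (2304 * N ^ 2 + 12 * N * k ^ 2)"
        by (simp only: of_nat_le_iff)
      then have "real (card (rich k)) * real k ^ 3 \<le> 2304 * real N ^ 2 + 12 * real N * real k ^ 2"
        by simp
      also have "\<dots> \<le> 2304 * real N ^ 2 + 12 * real N * (C\<^sup>2 * real N)"
        using k2 by (intro add_left_mono mult_left_mono) auto
      also have "\<dots> = K * real N ^ 2"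
        by (simp add: K_def power2_eq_square algebra_simps)
      finally show ?thesis .
    qed
    then show "real (card (rich k)) * real k ^ 2 \<le> K * real N ^ 2 * (1 / real k)"
      using k by (simp add: field_simps power_numeral_reduce)
  qed simp
  also have "\<dots> = 4 * K * real N ^ 2 * (\<Sum>k = 2..N. 1 / real k)"
    by (simp add: sum_distrib_left mult_ac)
  also have "\<dots> \<le> 4 * K * real N ^ 2 * ln (real N)"
    using sum_inverse_le_ln[OF \<open>N \<ge> 1\<close>] by (intro mult_left_mono) (simp_all add: K_def)
  finally show ?thesis by (simp add: K_def N_def)
qed

section \<open>Quadruples with prescribed ratio of slopes\<close>

text \<open>
  Given the pair \<open>e\<close>, choose the first point of \<open>f\<close> freely in \<open>S\<close>.  The slope of \<open>f\<close> being
  prescribed, the second point lies on a known line, which contains no more points than the line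
  through \<open>e\<close>.
\<close>
lemma poorer_partner_count:
  fixes S :: "(real ^ 2) set" and g :: "real \<Rightarrow> real"
  assumes "finite S"
  defines "Q \<equiv> {(e, f). e \<in> proper_pairs S \<and> f \<in> proper_pairs S \<and>
      slope (fst f) (snd f) = g (slope (fst e) (snd e)) \<and> richness S f \<le> richness S e}"
  shows "finite Q" "card Q \<le> card S * (\<Sum>e\<in>proper_pairs S. richness S e)"
proof -
  define B where "B = (\<lambda>e q. if card (S \<inter> graph_line (line_at (g (slope (fst e) (snd e))) q)) \<le> richness S e
    then S \<inter> graph_line (line_at (g (slope (fst e) (snd e))) q) else {})"
  have B: "finite (B e q)" "card (B e q) \<le> richness S e" for e q
    using assms(1) by (auto simp: B_def)
  let ?R = "SIGMA e:proper_pairs S. SIGMA q:S. B e q"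
  have finR: "finite ?R"
    using assms(1) B by (intro finite_SigmaI finite_proper_pairs)
  have sub: "Q \<subseteq> ?R"
  proof
    fix x assume "x \<in> Q"
    then obtain e q q' where x: "x = (e, q, q')" "e \<in> proper_pairs S" "(q, q') \<in> proper_pairs S"
      "slope q q' = g (slope (fst e) (snd e))" "richness S (q, q') \<le> richness S e"
      by (auto simp: Q_def)
    moreover have "q \<in> S" "q' \<in> S" "q' \<in> graph_line (line_at (slope q q') q)"
      using x(3) in_line_at_slope by (auto simp: proper_pairs_def)
    ultimately have "q' \<in> B e q" "q \<in> S"
      by (auto simp: B_def richness_def)
    then show "x \<in> ?R" using x by simp
  qed
  then show "finite Q" using finR finite_subset by blast
  have "card Q \<le> card ?R" using sub finR by (rule card_mono[rotated])
  also have "\<dots> = (\<Sum>e\<in>proper_pairs S. \<Sum>q\<in>S. card (B e q))"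
    using assms(1) B(1) by (simp add: card_SigmaI finite_proper_pairs)
  also have "\<dots> \<le> (\<Sum>e\<in>proper_pairs S. \<Sum>q\<in>S. richness S e)"
    using B(2) by (intro sum_mono)
  finally show "card Q \<le> card S * (\<Sum>e\<in>proper_pairs S. richness S e)"
    by (simp add: sum_distrib_left)
qed

text \<open>
  One of the two pairs of a quadruple spans a line with at least as many points as the other.  Either
  pair may be the richer one because \<open>l \<noteq> 0\<close> allows the slope of each to be recovered from the other.
\<close>
theorem slope_quadruples_le_collinear_triples:
  assumes "finite S" "l \<noteq> 0"
  shows "card (slope_quadruples l S) \<le> 2 * card S * (\<Sum>e\<in>proper_pairs S. richness S e)"
proof -
  let ?Q = "\<lambda>g. {(e, f). e \<in> proper_pairs S \<and> f \<in> proper_pairs S \<and>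
      slope (fst f) (snd f) = g (slope (fst e) (snd e)) \<and> richness S f \<le> richness S e}"
  let ?A = "(\<lambda>((p, p'), (q, q')). (p, p', q, q')) ` ?Q (\<lambda>s. l * s)"
  let ?B = "(\<lambda>((q, q'), (p, p')). (p, p', q, q')) ` ?Q (\<lambda>s. s / l)"
  note Q = poorer_partner_count[OF assms(1)]
  have "slope_quadruples l S \<subseteq> ?A \<union> ?B"
  proof
    fix x assume "x \<in> slope_quadruples l S"
    then obtain p p' q q' where x: "x = (p, p', q, q')" "(p, p') \<in> proper_pairs S" "(q, q') \<in> proper_pairs S"
      "l * slope p p' = slope q q'"
      by (auto simp: slope_quadruples_def proper_pairs_def)
    show "x \<in> ?A \<union> ?B"
    proof (cases "richness S (q, q') \<le> richness S (p, p')")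
      case True
      then have "((p, p'), (q, q')) \<in> ?Q (\<lambda>s. l * s)" using x by simp
      then have "x \<in> ?A" by (rule image_eqI[rotated]) (simp add: x)
      then show ?thesis ..
    next
      case False
      then have "((q, q'), (p, p')) \<in> ?Q (\<lambda>s. s / l)" using x assms(2) by (simp add: field_simps)
      then have "x \<in> ?B" by (rule image_eqI[rotated]) (simp add: x)
      then show ?thesis ..
    qed
  qed
  then have "card (slope_quadruples l S) \<le> card (?A \<union> ?B)"
    by (rule card_mono[rotated]) (intro finite_UnI finite_imageI Q)
  also have "\<dots> \<le> card ?A + card ?B"
    by (rule card_Un_le)
  also have "\<dots> \<le> card (?Q (\<lambda>s. l * s)) + card (?Q (\<lambda>s. s / l))"
    by (intro add_mono card_image_le Q)
  also have "\<dots> \<le> card S * (\<Sum>e\<in>proper_pairs S. richness S e) + card S * (\<Sum>e\<in>proper_pairs S. richness S e)"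
    by (intro add_mono Q)
  finally show ?thesis by simp
qed

theorem theorem5:
  fixes C :: real
  assumes "C > 0"
  shows "\<exists>C'>0. \<forall>(N::nat) (S::(real ^ 2) set).
           N \<ge> 2 \<longrightarrow> finite S \<longrightarrow> card S = N \<longrightarrow>
           (\<forall>L. straight_line L \<longrightarrow> real (card (S \<inter> L)) \<le> C * sqrt (real N)) \<longrightarrow>
           (\<forall>l::real. l \<noteq> 0 \<longrightarrow>
              real (card (slope_quadruples l S)) \<le> C' * real N ^ 3 * ln (real N))"
proof (intro exI[of _ "8 * (2304 + 12 * C\<^sup>2)"] conjI allI impI)
  show "0 < 8 * (2304 + 12 * C\<^sup>2)"
    by (simp add: add_pos_nonneg)
next
  fix N :: nat and S :: "(real ^ 2) set" and l :: real
  assume "N \<ge> 2" "finite S" and N: "card S = N" and "l \<noteq> 0"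
    and lines: "\<forall>L. straight_line L \<longrightarrow> real (card (S \<inter> L)) \<le> C * sqrt (real N)"
  let ?T = "\<Sum>e\<in>proper_pairs S. richness S e"
  have "S \<noteq> {}" using N \<open>N \<ge> 2\<close> by auto
  then have triples: "real ?T \<le> 4 * (2304 + 12 * C\<^sup>2) * real N ^ 2 * ln (real N)"
    using collinear_triples_bound[OF \<open>finite S\<close> _ assms] lines N by blast
  have "real (card (slope_quadruples l S)) \<le> real (2 * N * ?T)"
    using slope_quadruples_le_collinear_triples[OF \<open>finite S\<close> \<open>l \<noteq> 0\<close>] N
    by (simp only: of_nat_le_iff)
  also have "\<dots> = 2 * real N * real ?T"
    by simp
  also have "\<dots> \<le> 2 * real N * (4 * (2304 + 12 * C\<^sup>2) * real N ^ 2 * ln (real N))"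
    using triples by (intro mult_left_mono) auto
  also have "\<dots> = 8 * (2304 + 12 * C\<^sup>2) * real N ^ 3 * ln (real N)"
    by (simp add: power3_eq_cube power2_eq_square)
  finally show "real (card (slope_quadruples l S)) \<le> 8 * (2304 + 12 * C\<^sup>2) * real N ^ 3 * ln (real N)" .
qed

end
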